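(* Let $d\ge3$ and let $\mathcal{T}$ be a tree (with countably many vertices) in which some vertex $o$ has at least $d$ infinite disjoint paths emanating from it. Let $p,r\in(0,1)$ and let $X^{p,r}$ be the positively associated tree-indexed Markov chain on $\mathcal{T}$ with parameters $p$ and $r$. If $r<1/(1-r_2^{(d)})$, then $X^{p,r}\notin\mathcal{R}$.
   Context: Let $S$ be a finite or countably infinite set, and identify the power set $\mathcal{P}(S)$ with $\{0,1\}^S$ (product topology, Borel $\sigma$-algebra). For a $\sigma$-finite measure $\nu$ on $\mathcal{P}(S)\setminus\{\emptyset\}$, let $Y^\nu=\{B_j\}_{j\in I}$ be the Poisson process on $\mathcal{P}(S)\setminus\{\emptyset\}$ with intensity measure $\nu$. Define $X^\nu=(X^\nu_i)_{i\in S}$ by $X^\nu_i=1$ if $i\in\bigcup_{j\in I}B_j$ and $X^\nu_i=0$ otherwise. $\mathcal{R}$ denotes the set of all $\{0,1\}$-valued processes $(X_i)_{i\in S}$ that are equal in distribution to $X^\nu$ for some $\nu$. Here $S=V(\mathcal{T})$, the vertex set. The infinite paths emanating from $o$ are disjoint in the sense that they share only the vertex $o$. The tree-indexed Markov chain $X^{p,r}$ is the $\{0,1\}$-valued process indexed by $V(\mathcal{T})$ constructed as follows: fix a root and let its value be distributed as $r\delta_0+(1-r)\delta_1$; then sequentially, for each vertex $j$ adjacent to an already determined vertex $i$, let $X_j$ have distribution $(1-p)\delta_{X_i}+p(r\delta_0+(1-r)\delta_1)$, independently of everything else. (The law does not depend on the choice of root.) For integers $k\ge2$, the polylogarithm $\operatorname{Li}_{1-k}$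 is the rational function $\operatorname{Li}_{1-k}(z)=\bigl(z\frac{d}{dz}\bigr)^{k-1}\frac{z}{1-z}$ (the continuation of $\sum_{j\ge1}j^{k-1}z^j$). For $d\ge3$, $r_2^{(d)}\in(-\infty,0)$ denotes the largest strictly negative real root of $\operatorname{Li}_{1-d}$. *)

theory Defs
  imports "HOL-Probability.Probability"
begin

section \<open>Trees\<close>

text \<open>
  A simple graph is a vertex set \<open>V\<close> together with a symmetric, irreflexive adjacency
  relation \<open>E\<close> on \<open>V\<close>; degrees may be infinite.
\<close>

definition simple_graph :: "'v set \<Rightarrow> ('v \<Rightarrow> 'v \<Rightarrow> bool) \<Rightarrow> bool" where
  "simple_graph V E \<longleftrightarrow>
     (\<forall>u v. E u v \<longrightarrow> u \<in> V \<and> v \<in> V) \<and> (\<forall>u v. E u v \<longrightarrow> E v u) \<and> (\<forall>v. \<not> E v v)"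

definition connected_on :: "('v \<Rightarrow> 'v \<Rightarrow> bool) \<Rightarrow> 'v set \<Rightarrow> bool" where
  "connected_on E W \<longleftrightarrow> (\<forall>u\<in>W. \<forall>v\<in>W. (\<lambda>a b. E a b \<and> a \<in> W \<and> b \<in> W)\<^sup>*\<^sup>* u v)"

definition graph_cycle :: "('v \<Rightarrow> 'v \<Rightarrow> bool) \<Rightarrow> 'v list \<Rightarrow> bool" where
  "graph_cycle E xs \<longleftrightarrow>
     3 \<le> length xs \<and> distinct xs \<and> successively E xs \<and> E (last xs) (hd xs)"

definition is_tree :: "'v set \<Rightarrow> ('v \<Rightarrow> 'v \<Rightarrow> bool) \<Rightarrow> bool" where
  "is_tree V E \<longleftrightarrow>
     simple_graph V E \<and> V \<noteq> {} \<and> connected_on E V \<and> (\<forall>xs. \<not> graph_cycle E xs)"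

definition infinite_path_from :: "('v \<Rightarrow> 'v \<Rightarrow> bool) \<Rightarrow> 'v \<Rightarrow> (nat \<Rightarrow> 'v) \<Rightarrow> bool" where
  "infinite_path_from E v \<gamma> \<longleftrightarrow> \<gamma> 0 = v \<and> (\<forall>n. E (\<gamma> n) (\<gamma> (Suc n))) \<and> inj \<gamma>"

definition has_disjoint_infinite_paths :: "('v \<Rightarrow> 'v \<Rightarrow> bool) \<Rightarrow> 'v \<Rightarrow> nat \<Rightarrow> bool" where
  "has_disjoint_infinite_paths E v d \<longleftrightarrow>
     (\<exists>\<gamma> :: nat \<Rightarrow> nat \<Rightarrow> 'v.
        (\<forall>k<d. infinite_path_from E v (\<gamma> k)) \<and>
        (\<forall>k<d. \<forall>l<d. k \<noteq> l \<longrightarrow> range (\<gamma> k) \<inter> range (\<gamma> l) = {v}))"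

section \<open>Binary processes and their laws\<close>

text \<open>
  A \<open>{0,1}\<close>-valued process indexed by \<open>S\<close> is a family \<open>X\<close> of Boolean random variables on a
  probability space \<open>M\<close>, with \<open>True\<close> for 1 and \<open>False\<close> for 0.  For countable \<open>S\<close> the
  product \<open>\<sigma>\<close>-algebra below is the Borel \<open>\<sigma>\<close>-algebra of the product topology.
\<close>

abbreviation cube :: "'v set \<Rightarrow> ('v \<Rightarrow> bool) measure" where
  "cube S \<equiv> (\<Pi>\<^sub>M i\<in>S. count_space (UNIV :: bool set))"

definition process_law :: "'v set \<Rightarrow> 'w measure \<Rightarrow> ('v \<Rightarrow> 'w \<Rightarrow> bool) \<Rightarrow> ('v \<Rightarrow> bool) measure" where
  "process_law S M X = distr M (cube S) (\<lambda>\<omega>. \<lambda>i\<in>S. X i \<omega>)"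

section \<open>Poisson processes of subsets and the class \<open>\<R>\<close>\<close>

text \<open>
  The \<open>\<sigma>\<close>-algebra on the power set of \<open>S\<close> is the one of \<open>cube S\<close>, transported along
  the identification of a set with its indicator function.
\<close>

definition powerset_space :: "'v set \<Rightarrow> 'v set measure" where
  "powerset_space S = vimage_algebra (Pow S) (\<lambda>B. \<lambda>i\<in>S. i \<in> B) (cube S)"

definition nonempty_powerset_space :: "'v set \<Rightarrow> 'v set measure" where
  "nonempty_powerset_space S = restrict_space (powerset_space S) (Pow S - {{}})"

text \<open>
  A countable random collection \<open>{B\<^sub>j}\<close> of points, with repetitions allowed, is given by a
  random index set \<open>I \<omega>\<close> of natural numbers and the points \<open>B j \<omega>\<close> for \<open>j \<in> I \<omega>\<close>.  The
  number of points in a set is counted with multiplicity, with values in \<open>[0,\<infinity>]\<close>.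
\<close>

definition point_count :: "('w \<Rightarrow> nat set) \<Rightarrow> (nat \<Rightarrow> 'w \<Rightarrow> 'b) \<Rightarrow> 'b set \<Rightarrow> 'w \<Rightarrow> ennreal" where
  "point_count I B A \<omega> = emeasure (count_space UNIV) {j \<in> I \<omega>. B j \<omega> \<in> A}"

definition has_poisson_distribution :: "'w measure \<Rightarrow> ('w \<Rightarrow> ennreal) \<Rightarrow> ennreal \<Rightarrow> bool" where
  "has_poisson_distribution M N m \<longleftrightarrow>
     (if m = \<infinity> then AE \<omega> in M. N \<omega> = \<infinity>
      else \<forall>n::nat. measure M {\<omega> \<in> space M. N \<omega> = of_nat n}
                     = enn2real m ^ n / fact n * exp (- enn2real m))"

definition poisson_process ::
  "'w measure \<Rightarrow> 'b measure \<Rightarrow> ('w \<Rightarrow> nat set) \<Rightarrow> (nat \<Rightarrow> 'w \<Rightarrow> 'b) \<Rightarrow> bool" where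
  "poisson_process M \<nu> I B \<longleftrightarrow>
     prob_space M \<and>
     (\<forall>\<omega>\<in>space M. \<forall>j\<in>I \<omega>. B j \<omega> \<in> space \<nu>) \<and>
     (\<forall>A\<in>sets \<nu>. point_count I B A \<in> borel_measurable M \<and>
                   has_poisson_distribution M (point_count I B A) (emeasure \<nu> A)) \<and>
     (\<forall>\<A>. finite \<A> \<and> \<A> \<subseteq> sets \<nu> \<and> disjoint \<A> \<longrightarrow>
            prob_space.indep_vars M (\<lambda>_. borel) (point_count I B) \<A>)"

definition covered :: "('w \<Rightarrow> nat set) \<Rightarrow> (nat \<Rightarrow> 'w \<Rightarrow> 'v set) \<Rightarrow> 'v \<Rightarrow> 'w \<Rightarrow> bool" where
  "covered I B i \<omega> \<longleftrightarrow> i \<in> (\<Union>j\<in>I \<omega>. B j \<omega>)"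

text \<open>
  The class \<open>\<R>\<close>, as a set of laws.  HOL cannot quantify over the type carrying the
  probability space on which the Poisson process lives, so this type is a parameter.  A statement
  of non-membership for an arbitrary type \<open>'w\<close> excludes every realisation.
\<close>

definition class_R :: "'w itself \<Rightarrow> 'v set \<Rightarrow> ('v \<Rightarrow> bool) measure set" where
  "class_R TYPE('w) S =
     {L. \<exists>(\<nu> :: 'v set measure) (M :: 'w measure) I B.
           sets \<nu> = sets (nonempty_powerset_space S) \<and> sigma_finite_measure \<nu> \<and>
           poisson_process M \<nu> I B \<and> L = process_law S M (covered I B)}"

section \<open>Tree-indexed Markov chains\<close>

definition markov_step :: "real \<Rightarrow> real \<Rightarrow> bool \<Rightarrow> bool pmf" where
  "markov_step p r x =
     bind_pmf (bernoulli_pmf p) (\<lambda>c. if c then bernoulli_pmf (1 - r) else return_pmf x)"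

text \<open>
  \<open>F\<close> ranges over the possible sets of already determined vertices in the sequential
  construction from the root \<open>\<rho>\<close>.  Given the values on \<open>F\<close>, the value at a new vertex \<open>j\<close>
  adjacent to \<open>i \<in> F\<close> is drawn from \<open>markov_step p r (X i)\<close>.
\<close>

definition tree_markov_chain ::
  "'v set \<Rightarrow> ('v \<Rightarrow> 'v \<Rightarrow> bool) \<Rightarrow> real \<Rightarrow> real \<Rightarrow> 'a measure \<Rightarrow> ('v \<Rightarrow> 'a \<Rightarrow> bool) \<Rightarrow> bool" where
  "tree_markov_chain V E p r M X \<longleftrightarrow>
     prob_space M \<and>
     (\<forall>i\<in>V. X i \<in> measurable M (count_space UNIV)) \<and>
     (\<exists>\<rho>\<in>V.
        (\<forall>b. measure M {\<omega> \<in> space M. X \<rho> \<omega> = b} = pmf (bernoulli_pmf (1 - r)) b) \<and>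
        (\<forall>F i j x b.
           finite F \<and> F \<subseteq> V \<and> \<rho> \<in> F \<and> connected_on E F \<and> i \<in> F \<and> j \<in> V - F \<and> E i j \<longrightarrow>
           measure M {\<omega> \<in> space M. (\<forall>k\<in>F. X k \<omega> = x k) \<and> X j \<omega> = b} =
           measure M {\<omega> \<in> space M. \<forall>k\<in>F. X k \<omega> = x k} * pmf (markov_step p r (x i)) b))"

section \<open>Polylogarithms of negative integer order\<close>

text \<open>
  \<open>polylog_one_minus k\<close> is \<open>Li\<^bsub>1-k\<^esub>\<close> on the real line.  The pole 1 is the only point where the
  value is not that of the rational function.
\<close>

definition polylog_one_minus :: "nat \<Rightarrow> real \<Rightarrow> real" where
  "polylog_one_minus k = ((\<lambda>f z. z * deriv f z) ^^ (k - 1)) (\<lambda>z. z / (1 - z))"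

definition r2 :: "nat \<Rightarrow> real" where
  "r2 d = (GREATEST z. z < 0 \<and> polylog_one_minus d z = 0)"

end

theory Submission
  imports Defs "HOL-Computational_Algebra.Polynomial"
begin

text \<open>
  If the chain were a Poisson process \<open>X\<^sup>\<nu>\<close>, then \<open>- ln P(X = 0 on J)\<close> would be the \<open>\<nu>\<close>-measure of the
  sets that meet \<open>J\<close>, so by inclusion-exclusion the alternating sum of \<open>ln P(X = 0 on J)\<close> over all
  subsets \<open>J\<close> of a finite set \<open>K\<close> would be the \<open>\<nu>\<close>-measure of the sets containing \<open>K\<close>, hence
  nonnegative.  Take for \<open>K\<close> the vertices at distance \<open>n\<close> from \<open>o\<close> on \<open>k \<le> d\<close> of the paths.  Then the
  alternating sum is a \<open>k\<close>-th backward difference, with a step tending to 0 as \<open>n\<close> grows, of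
  \<open>s \<mapsto> ln (r + (1 - r) e\<^sup>s)\<close> up to a linear term, so its sign is that of the \<open>k\<close>-th derivative at 0.  This
  derivative is a polynomial \<open>P\<close> in the sigmoid \<open>(1 - r) e\<^sup>s / (r + (1 - r) e\<^sup>s)\<close>, related to the polylogarithm by
  \<open>Li\<^bsub>1-k\<^esub>(z) = - P(z / (z - 1))\<close>.  By interlacing of zeros, the hypothesis on \<open>r\<close> makes this derivative
  negative for some \<open>k\<close> between 3 and \<open>d\<close>; the order \<open>k = d\<close> itself need not work.
\<close>

section \<open>The polynomials behind the polylogarithms\<close>

text \<open>Iterated derivatives: if \<open>S' = S * (1 - S)\<close>, then
  \<open>sigmoid_poly m\<close> evaluated at \<open>S\<close> is the \<open>m\<close>-th derivative
  of \<open>S\<close>. For \<open>S\<close> the derivative of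
  \<open>ln (r + (1 - r) * exp s)\<close>, index \<open>m\<close> therefore belongs to order
  \<open>m + 1\<close> of the logarithm.\<close>

primrec sigmoid_poly :: "nat \<Rightarrow> real poly" where
  "sigmoid_poly 0 = [:0, 1:]"
| "sigmoid_poly (Suc m) = [:0, 1, -1:] * pderiv (sigmoid_poly m)"

lemma poly_sigmoid_poly_Suc:
  "poly (sigmoid_poly (Suc m)) x = x * (1 - x) * poly (pderiv (sigmoid_poly m)) x"
  by (simp add: algebra_simps)

lemma degree_sigmoid_poly_le: "degree (sigmoid_poly m) \<le> Suc m"
proof (induction m)
  case (Suc m)
  have "degree (sigmoid_poly (Suc m)) \<le> degree [:0, 1, - 1 :: real:] + degree (pderiv (sigmoid_poly m))"
    unfolding sigmoid_poly.simps by (rule degree_mult_le)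
  also have "\<dots> \<le> Suc (Suc m)"
    using Suc by (simp add: degree_pderiv)
  finally show ?case .
qed simp

text \<open>The factor \<open>x * (1 - x)\<close> vanishes at 0 with slope 1, so the recursion
  preserves the slope at 0. This normalisation later fixes all signs.\<close>

lemma pderiv_sigmoid_poly_0: "poly (pderiv (sigmoid_poly m)) 0 = 1"
proof (induction m)
  case (Suc m)
  then show ?case
    by (simp only: sigmoid_poly.simps pderiv_mult poly_add poly_mult) (simp add: pderiv_pCons)
qed (simp add: pderiv_pCons)

text \<open>The substitution \<open>x = z / (z - 1)\<close> turns the operator \<open>z d/dz\<close>
  into \<open>x (1 - x) d/dx\<close>, which is the recursion of \<open>sigmoid_poly\<close>, and the
  starting function \<open>z / (1 - z)\<close> into \<open>- x\<close>.\<close>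

lemma polylog_one_minus_eq:
  "z < 1 \<Longrightarrow> polylog_one_minus (Suc m) z = - poly (sigmoid_poly m) (z / (z - 1))"
proof (induction m arbitrary: z)
  case 0
  then show ?case
    by (simp add: polylog_one_minus_def field_simps)
next
  case (Suc m)
  \<comment> \<open>\<open>deriv\<close> at \<open>z\<close> depends on values near
    \<open>z\<close>, so the induction hypothesis is needed on the whole open half-line, not only at
    \<open>z\<close>.\<close>
  have ev: "eventually (\<lambda>w. polylog_one_minus (Suc m) w = - poly (sigmoid_poly m) (w / (w - 1))) (nhds z)"
    using eventually_nhds_in_open[of "{..<1}" z] Suc.prems
    by (auto elim!: eventually_mono intro: Suc.IH)
  have "((\<lambda>w. w / (w - 1)) has_real_derivative - 1 / (z - 1)\<^sup>2) (at z)"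
    using Suc.prems by (auto intro!: derivative_eq_intros simp: power2_eq_square divide_simps)
  from DERIV_minus[OF DERIV_chain2[OF poly_DERIV this]]
  have "deriv (polylog_one_minus (Suc m)) z =
      - (poly (pderiv (sigmoid_poly m)) (z / (z - 1)) * (- 1 / (z - 1)\<^sup>2))"
    using DERIV_imp_deriv deriv_cong_ev[OF ev refl] by metis
  moreover have "polylog_one_minus (Suc (Suc m)) z = z * deriv (polylog_one_minus (Suc m)) z"
    by (simp add: polylog_one_minus_def)
  moreover have "z / (z - 1) * (1 - z / (z - 1)) = - z / (z - 1)\<^sup>2"
    using Suc.prems by (simp add: field_simps power2_eq_square)
  ultimately show ?case
    by (simp only: poly_sigmoid_poly_Suc) simp
qed

lemma sigmoid_poly_factor:
  assumes incr: "\<And>i. i < m \<Longrightarrow> x i < x (Suc i)"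
    and roots: "\<And>i. i \<le> m \<Longrightarrow> poly (sigmoid_poly m) (x i) = 0"
  obtains c where "\<And>t. poly (sigmoid_poly m) t = c * (\<Prod>i\<le>m. t - x i)"
proof -
  have less: "x i < x j" if "i < j" "j \<le> m" for i j
    using that
  proof (induction j)
    case (Suc j)
    then show ?case
      using incr[of j] by (cases "i = j") auto
  qed simp
  have inj: "inj_on x {..m}"
    by (intro linorder_inj_onI) (use less in fastforce)+
  define q where "q = (\<Prod>i\<le>m. [:- x i, 1:])"
  define c where "c = coeff (sigmoid_poly m) (Suc m)"
  have lq: "lead_coeff q = 1"
    unfolding q_def lead_coeff_prod by simp
  have dq: "degree q = Suc m"
    unfolding q_def by (subst degree_prod_eq_sum_degree) auto
  \<comment> \<open>Both sides have degree at most \<open>m + 1\<close> and the same coefficient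
    there, so their difference has degree at most \<open>m\<close>; it vanishes at
    \<open>m + 1\<close> distinct points.\<close>
  have "sigmoid_poly m = smult c q"
  proof (rule poly_eqI_degree_lead_coeff[of _ "Suc m" _ "x ` {..m}"])
    show "coeff (sigmoid_poly m) (Suc m) = coeff (smult c q) (Suc m)"
      using lq dq by (simp add: c_def)
    show "poly (sigmoid_poly m) t = poly (smult c q) t" if "t \<in> x ` {..m}" for t
      using that roots by (auto simp: q_def poly_prod)
  qed (use degree_sigmoid_poly_le dq in \<open>auto simp: card_image[OF inj]\<close>)
  then have "poly (sigmoid_poly m) t = c * (\<Prod>i\<le>m. t - x i)" for t
    by (simp add: q_def poly_prod)
  then show ?thesis using that by blast
qed

text \<open>Apart from \<open>t\<close> and \<open>t - x 1\<close>, the factorisation leaves a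
  factor without zeros on \<open>[0, x 2)\<close>. Its sign there is constant and is read off at 0,
  where the polynomial has slope 1.\<close>

lemma sigmoid_poly_sign:
  assumes m: "1 \<le> m" and x0: "x 0 = 0"
    and incr: "\<And>i. i < m \<Longrightarrow> x i < x (Suc i)"
    and roots: "\<And>i. i \<le> m \<Longrightarrow> poly (sigmoid_poly m) (x i) = 0"
    and t: "0 < t" and t2: "2 \<le> m \<Longrightarrow> t < x 2"
  shows "\<exists>b<0. poly (sigmoid_poly m) t = t * (t - x 1) * b"
proof -
  obtain c where c: "\<And>t. poly (sigmoid_poly m) t = c * (\<Prod>i\<le>m. t - x i)"
    using sigmoid_poly_factor[of m x] incr roots by blast
  define R where "R s = (\<Prod>i\<in>{2..m}. s - x i)" for s
  have eq: "poly (sigmoid_poly m) s = s * ((s - x 1) * c * R s)" for s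
  proof -
    have "{..m} = insert 0 (insert 1 {2..m})"
      using m by auto
    then show ?thesis
      unfolding c by (simp add: R_def x0)
  qed
  have x2: "t < x i" if "2 \<le> i" "i \<le> m" for i
    using that
  proof (induction i rule: dec_induct)
    case base
    then show ?case using t2 by simp
  next
    case (step i)
    then show ?case using incr[of i] by simp
  qed
  \<comment> \<open>For a function \<open>s * g s\<close> the difference quotient at 0 is
    \<open>g s\<close> itself, so the derivative is the limit of \<open>g\<close>.\<close>
  have deriv: "((\<lambda>s. s * ((s - x 1) * c * R s)) has_real_derivative - x 1 * c * R 0) (at 0)"
  proof -
    have "(\<lambda>s. (s - x 1) * c * R s) \<midarrow>0\<rightarrow> (0 - x 1) * c * R 0"
      unfolding R_def by (intro tendsto_intros)
    then show ?thesis
      unfolding has_field_derivative_iff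
      by (rule tendsto_eq_rhs[OF Lim_transform_eventually])
        (auto simp: eventually_at intro!: exI[of _ 1])
  qed
  have "- x 1 * c * R 0 = 1"
    using DERIV_unique[OF deriv[folded eq] poly_DERIV] by (simp add: pderiv_sigmoid_poly_0)
  moreover have "x 1 > 0"
    using incr[of 0] m x0 by simp
  ultimately have "c * R 0 < 0"
    by (smt (verit) mult.assoc mult_minus_left zero_le_mult_iff)
  \<comment> \<open>Each \<open>x i\<close> with \<open>i \<ge> 2\<close> lies to the right of both
    0 and \<open>t\<close>, so paired factors are both negative.\<close>
  moreover have "R t * R 0 > 0"
    unfolding R_def prod.distrib[symmetric] using x2 t
    by (intro prod_pos ballI mult_neg_neg) (use x2 in fastforce)+
  ultimately have "c * R t < 0"
    by (smt (verit) mult_neg_neg mult_pos_pos mult_less_0_iff zero_less_mult_iff)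
  then show ?thesis
    using eq[of t] by (intro exI[of _ "c * R t"]) (simp add: mult_ac)
qed

text \<open>
  Rolle's theorem makes the zeros of consecutive polynomials interlace, so each of them is negative
  from its own first zero up to at least the first zero of its predecessor.
\<close>

lemma sigmoid_poly_roots:
  assumes "2 \<le> m"
  shows "\<exists>x. x 0 = 0 \<and> x m = 1 \<and> (\<forall>i<m. x i < x (Suc i)) \<and>
      (\<forall>i\<le>m. poly (sigmoid_poly m) (x i) = 0) \<and>
      (\<forall>t. x 1 < t \<and> t < 1 \<longrightarrow> (\<exists>l\<in>{2..m}. poly (sigmoid_poly l) t < 0))"
  using assms
proof (induction m rule: dec_induct)
  case base
  have eq: "poly (sigmoid_poly 2) t = t * (1 - t) * (1 - 2 * t)" for t
    by (simp add: numeral_2_eq_2 pderiv_pCons algebra_simps)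
  have "t * (1 - t) * (1 - 2 * t) < 0" if "1 / 2 < t" "t < 1" for t :: real
    using that by (intro mult_pos_neg mult_pos_pos) auto
  then have "\<forall>t. 1 / 2 < t \<and> t < 1 \<longrightarrow> (\<exists>l\<in>{2..2}. poly (sigmoid_poly l) t < 0)"
    by (simp add: eq)
  moreover have "\<forall>i\<le>2. poly (sigmoid_poly 2) (real i / 2) = 0"
    unfolding eq by (auto simp: le_Suc_eq numeral_2_eq_2)
  ultimately show ?case
    by (intro exI[of _ "\<lambda>i. real i / 2"]) simp
next
  case (step m)
  then obtain x where x0: "x 0 = 0" and xm: "x m = 1" and incr: "\<And>i. i < m \<Longrightarrow> x i < x (Suc i)"
    and roots: "\<And>i. i \<le> m \<Longrightarrow> poly (sigmoid_poly m) (x i) = 0"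
    and neg: "\<And>t. x 1 < t \<Longrightarrow> t < 1 \<Longrightarrow> \<exists>l\<in>{2..m}. poly (sigmoid_poly l) t < 0"
    by blast
  have "\<exists>y. x i < y \<and> y < x (Suc i) \<and> poly (pderiv (sigmoid_poly m)) y = 0" if "i < m" for i
    using poly_MVT[OF incr[OF that], of "sigmoid_poly m"] roots[of i] roots[of "Suc i"] incr[OF that] that
    by auto
  then obtain y where y: "\<And>i. i < m \<Longrightarrow> x i < y i" "\<And>i. i < m \<Longrightarrow> y i < x (Suc i)"
      "\<And>i. i < m \<Longrightarrow> poly (pderiv (sigmoid_poly m)) (y i) = 0"
    by metis
  \<comment> \<open>The zeros of the next polynomial: 0 and 1 come from the factor
    \<open>x * (1 - x)\<close>, those in between from Rolle's theorem, with the index shifted by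
    one.\<close>
  define x' where "x' i = (if i = 0 then 0 else if i = Suc m then 1 else y (i - 1))" for i
  have incr': "x' i < x' (Suc i)" if i: "i < Suc m" for i
  proof -
    consider "i = 0" | "0 < i" "i < m" | "0 < i" "i = m"
      using i by linarith
    then show ?thesis
    proof cases
      case 2
      then have "y (i - 1) < x i"
        using y(2)[of "i - 1"] by simp
      then show ?thesis
        using y(1)[of i] 2 by (simp add: x'_def)
    qed (use y(1)[of 0] y(2)[of "m - 1"] step.hyps x0 xm in \<open>auto simp: x'_def\<close>)
  qed
  have roots': "poly (sigmoid_poly (Suc m)) (x' i) = 0" if "i \<le> Suc m" for i
    unfolding poly_sigmoid_poly_Suc using that y(3)[of "i - 1"] by (auto simp: x'_def)
  have "\<exists>l\<in>{2..Suc m}. poly (sigmoid_poly l) t < 0" if t: "x' 1 < t" "t < 1" for t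
  proof (cases "x 1 < t")
    case True
    then show ?thesis using neg[of t] t by force
  next
    case False
    \<comment> \<open>Here \<open>t \<le> x 1 < y 1 = x' 2\<close>, so \<open>t\<close> lies between
      the first two positive zeros of the new polynomial, where that polynomial is negative.\<close>
    have "t < x' 2"
      using False y(1)[of 1] step.hyps by (auto simp: x'_def)
    moreover have "0 < x' 1"
      using incr'[of 0] by (simp add: x'_def)
    ultimately obtain b where "b < 0" "poly (sigmoid_poly (Suc m)) t = t * (t - x' 1) * b"
      using sigmoid_poly_sign[of "Suc m" x' t] incr' roots' t by (auto simp: x'_def)
    then have "poly (sigmoid_poly (Suc m)) t < 0"
      using t \<open>0 < x' 1\<close> by (simp add: mult_pos_neg)
    then show ?thesis
      using step.hyps by (intro bexI[of _ "Suc m"]) auto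
  qed
  then show ?case
    using incr' roots' by (intro exI[of _ x']) (auto simp: x'_def)
qed

text \<open>The map \<open>z \<mapsto> z / (z - 1)\<close> is a decreasing bijection from the
  negative half-line to \<open>(0, 1)\<close>. The largest negative root of the polylogarithm thus
  corresponds to the smallest positive zero \<open>x 1\<close> of
  \<open>sigmoid_poly (d - 1)\<close>, and the hypothesis on \<open>r\<close> becomes
  \<open>x 1 < 1 - r\<close>.\<close>

lemma sigmoid_poly_neg_of_less_r2:
  assumes d: "3 \<le> d" and r: "0 < r" "r < 1 / (1 - r2 d)"
  obtains m where "2 \<le> m" "m < d" "poly (sigmoid_poly m) (1 - r) < 0"
proof -
  obtain n where n: "d = Suc n" "2 \<le> n"
    using d by (cases d) auto
  obtain x where x0: "x 0 = 0" and xn: "x n = 1" and incr: "\<And>i. i < n \<Longrightarrow> x i < x (Suc i)"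
    and roots: "\<And>i. i \<le> n \<Longrightarrow> poly (sigmoid_poly n) (x i) = 0"
    and neg: "\<And>t. x 1 < t \<Longrightarrow> t < 1 \<Longrightarrow> \<exists>l\<in>{2..n}. poly (sigmoid_poly l) t < 0"
    using sigmoid_poly_roots[OF n(2)] by blast
  have le: "x 2 \<le> x i" if "2 \<le> i" "i \<le> n" for i
    using that
  proof (induction i rule: dec_induct)
    case (step i)
    then show ?case using incr[of i] by simp
  qed simp
  have x1: "0 < x 1" "x 1 < 1"
    using incr[of 0] incr[of 1] le[of n] n x0 xn by (auto simp: numeral_2_eq_2)
  have first: "x 1 \<le> t" if "0 < t" "poly (sigmoid_poly n) t = 0" for t
  proof (rule ccontr)
    assume "\<not> x 1 \<le> t"
    then have "t < x 2"
      using incr[of 1] n by (simp add: numeral_2_eq_2)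
    with that obtain b where "b < 0" "poly (sigmoid_poly n) t = t * (t - x 1) * b"
      using sigmoid_poly_sign[of n x t] x0 incr roots n by auto
    then show False
      using that \<open>\<not> x 1 \<le> t\<close> by auto
  qed
  \<comment> \<open>The map \<open>z \<mapsto> z / (z - 1)\<close> is its own inverse, so this is
    the preimage of \<open>x 1\<close>.\<close>
  define z where "z = x 1 / (x 1 - 1)"
  have z: "z < 0" "z / (z - 1) = x 1"
    using x1 by (auto simp: z_def divide_simps)
  have "r2 d = z"
    unfolding r2_def
  proof (rule Greatest_equality)
    show "z < 0 \<and> polylog_one_minus d z = 0"
      using z roots[of 1] n by (simp add: polylog_one_minus_eq)
  next
    fix u :: real
    assume u: "u < 0 \<and> polylog_one_minus d u = 0"
    then have "x 1 \<le> u / (u - 1)"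
      using n by (intro first) (auto simp: polylog_one_minus_eq divide_neg_neg)
    with u x1 show "u \<le> z"
      by (auto simp: z_def field_simps)
  qed
  then have "1 - r2 d = 1 / (1 - x 1)"
    using x1 by (simp add: z_def field_simps)
  then have "1 / (1 - r2 d) = 1 - x 1"
    by simp
  then have "r < 1 - x 1"
    using r by simp
  then show ?thesis
    using neg[of "1 - r"] r n that by auto
qed

section \<open>Finite differences of the logarithm\<close>

lemma sum_Pow_insert:
  fixes f :: "'a set \<Rightarrow> real"
  assumes "finite K" "l \<notin> K"
  shows "(\<Sum>J\<in>Pow (insert l K). f J) = (\<Sum>J\<in>Pow K. f J + f (insert l J))"
proof -
  have "inj_on (insert l) (Pow K)" "Pow K \<inter> insert l ` Pow K = {}"
    using assms(2) by (auto simp: inj_on_def)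
  then show ?thesis
    using assms(1) by (simp add: Pow_insert sum.union_disjoint sum.reindex sum.distrib)
qed

text \<open>The sum is the backward difference of order \<open>card K\<close> with step
  \<open>w\<close>. Splitting off one element of \<open>K\<close> replaces the tower
  \<open>D\<close> by its first differences, and the mean value theorem trades that difference for
  one more derivative.\<close>

lemma backward_difference_pos:
  fixes D :: "nat \<Rightarrow> real \<Rightarrow> real" and t w :: real
  assumes "finite K" "0 < w"
    and "\<And>m s. m < card K \<Longrightarrow> (D m has_real_derivative D (Suc m) s) (at s)"
    and "\<And>s. t - card K * w \<le> s \<Longrightarrow> s \<le> t \<Longrightarrow> 0 < D (card K) s"
  shows "0 < (\<Sum>J\<in>Pow K. (-1) ^ card J * D 0 (t - card J * w))"
  using assms
proof (induction K arbitrary: D rule: finite_induct)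
  case empty
  then show ?case by simp
next
  case (insert l K)
  define G where "G m s = D m s - D m (s - w)" for m s
  have "0 < (\<Sum>J\<in>Pow K. (-1) ^ card J * G 0 (t - card J * w))"
  proof (rule insert.IH)
    show "(G m has_real_derivative G (Suc m) s) (at s)" if "m < card K" for m s
    proof -
      have D: "(D m has_real_derivative D (Suc m) u) (at u)" for u
        using that insert.prems(2) insert.hyps by simp
      show ?thesis
        unfolding G_def by (auto intro!: derivative_eq_intros D DERIV_chain2[OF D])
    qed
    show "0 < G (card K) s" if s: "t - card K * w \<le> s" "s \<le> t" for s
    proof -
      obtain u where u: "s - w < u" "u < s"
          "D (card K) s - D (card K) (s - w) = (s - (s - w)) * D (Suc (card K)) u"
        using MVT2[of "s - w" s "D (card K)" "D (Suc (card K))"] insert by auto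
      \<comment> \<open>The intermediate point may lie up to \<open>w\<close> to the left of
        \<open>s\<close>; the interval in the positivity hypothesis grows by just that much per
        element.\<close>
      moreover have "0 < D (Suc (card K)) u"
        using insert.prems(3)[of u] insert.hyps s u by (simp add: algebra_simps)
      ultimately show ?thesis
        using \<open>0 < w\<close> by (simp add: G_def)
    qed
  qed (use insert in auto)
  also have "\<dots> = (\<Sum>J\<in>Pow (insert l K). (-1) ^ card J * D 0 (t - card J * w))"
    unfolding sum_Pow_insert[OF insert.hyps]
  proof (rule sum.cong[OF refl])
    fix J assume "J \<in> Pow K"
    then have "card (insert l J) = Suc (card J)"
      using insert.hyps by (auto simp: finite_subset card_insert_if)
    then show "(-1) ^ card J * G 0 (t - card J * w) =
        (-1) ^ card J * D 0 (t - card J * w) + (-1) ^ card (insert l J) * D 0 (t - card (insert l J) * w)"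
      by (simp add: G_def algebra_simps)
  qed
  finally show ?case .
qed

lemma sigmoid_poly_deriv_chain:
  fixes S :: "real \<Rightarrow> real"
  assumes "(S has_real_derivative S s * (1 - S s)) (at s)"
  shows "((\<lambda>s. poly (sigmoid_poly m) (S s)) has_real_derivative poly (sigmoid_poly (Suc m)) (S s)) (at s)"
  using DERIV_chain2[OF poly_DERIV assms, of "sigmoid_poly m"]
  by (simp only: poly_sigmoid_poly_Suc) (simp add: mult_ac)

text \<open>
  With \<open>w = ln (u / v)\<close>, the argument of the logarithm is \<open>u ^ j * (r + (1 - r) * exp (- j * w))\<close>;
  the derivatives of \<open>ln (r + (1 - r) * exp s)\<close> are the polynomials evaluated at a sigmoid
  that takes the value \<open>1 - r\<close> at 0.
\<close>

lemma alternating_log_sum_neg: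
  fixes r :: real
  assumes r: "0 < r" "r < 1" and m: "2 \<le> m" and neg: "poly (sigmoid_poly m) (1 - r) < 0"
    and K: "finite K" "card K = Suc m"
  obtains \<delta> where "0 < \<delta>"
    "\<And>u v. 0 < v \<Longrightarrow> v < u \<Longrightarrow> ln (u / v) < \<delta> \<Longrightarrow>
       (\<Sum>J\<in>Pow K. (-1) ^ card J * ln (r * u ^ card J + (1 - r) * v ^ card J)) < 0"
proof -
  define S where "S s = (1 - r) * exp s / (r + (1 - r) * exp s)" for s
  have pos: "0 < r + (1 - r) * exp s" for s
    using r by (intro add_pos_pos mult_pos_pos) auto
  have S: "(S has_real_derivative S s * (1 - S s)) (at s)" for s
  proof -
    have "1 - S s = r / (r + (1 - r) * exp s)"
      using pos[of s] by (simp add: S_def field_simps)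
    then have "S s * (1 - S s) = r * ((1 - r) * exp s) / (r + (1 - r) * exp s)\<^sup>2"
      by (simp add: S_def power2_eq_square)
    moreover have "(S has_real_derivative r * ((1 - r) * exp s) / (r + (1 - r) * exp s)\<^sup>2) (at s)"
      unfolding S_def using pos[of s]
      by (auto intro!: derivative_eq_intros simp: power2_eq_square algebra_simps)
    ultimately show ?thesis by simp
  qed
  have "isCont (\<lambda>s. poly (sigmoid_poly m) (S s)) 0"
    using sigmoid_poly_deriv_chain[OF S] by (rule DERIV_isCont)
  moreover have "poly (sigmoid_poly m) (S 0) < 0"
    using neg by (simp add: S_def)
  ultimately have "eventually (\<lambda>s. poly (sigmoid_poly m) (S s) < 0) (nhds 0)"
    using tendsto_at_iff_tendsto_nhds[of "\<lambda>s. poly (sigmoid_poly m) (S s)" 0] order_tendstoD(2)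
    unfolding isCont_def by blast
  then obtain e where e: "0 < e" "\<And>s. \<bar>s\<bar> < e \<Longrightarrow> poly (sigmoid_poly m) (S s) < 0"
    by (auto simp: eventually_nhds_metric dist_real_def)
  show ?thesis
  \<comment> \<open>\<open>K\<close> has \<open>m + 1\<close> elements, so the difference looks back
    by \<open>(m + 1) * w\<close>, which must stay below \<open>e\<close>.\<close>
  proof (rule that[of "e / (m + 1)"])
    show "0 < e / (m + 1)"
      using e by simp
    fix u v :: real
    assume uv: "0 < v" "v < u" and w_less: "ln (u / v) < e / (m + 1)"
    define w where "w = ln (u / v)"
    have w: "0 < w" "Suc m * w < e"
      using uv w_less by (auto simp: w_def field_simps)
    \<comment> \<open>At \<open>s = - j * w\<close> the linear term \<open>\<mu> * s\<close> equals
      \<open>- j * ln u\<close> and so accounts for the factor \<open>u ^ j\<close>.\<close>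
    define \<mu> where "\<mu> = ln u / w"
    \<comment> \<open>The logarithm enters with a minus sign, so that a negative polynomial gives a
      positive derivative. The linear term survives only up to the first derivative, hence not at
      order \<open>m + 1\<close>.\<close>
    define D where "D n s = (case n of 0 \<Rightarrow> \<mu> * s - ln (r + (1 - r) * exp s)
        | Suc n \<Rightarrow> (if n = 0 then \<mu> else 0) - poly (sigmoid_poly n) (S s))" for n s
    have "(D n has_real_derivative D (Suc n) s) (at s)" for n s
    proof (cases n)
      case 0
      then show ?thesis
        unfolding D_def using pos[of s]
        by (auto intro!: derivative_eq_intros simp: S_def)
    next
      case (Suc k)
      show ?thesis
        unfolding D_def Suc nat.case
        using DERIV_diff[OF DERIV_const sigmoid_poly_deriv_chain[OF S]]
        by (simp del: sigmoid_poly.simps)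
    qed
    moreover have "0 < D (card K) s" if "0 - card K * w \<le> s" "s \<le> 0" for s
      using e(2)[of s] that w m by (auto simp: D_def K)
    ultimately have "0 < (\<Sum>J\<in>Pow K. (-1) ^ card J * D 0 (0 - card J * w))"
      using K w by (intro backward_difference_pos) auto
    moreover have "D 0 (0 - j * w) = - ln (r * u ^ j + (1 - r) * v ^ j)" for j :: nat
    proof -
      have "v = u * exp (- w)"
        using uv by (simp add: w_def exp_minus exp_ln)
      then have "v ^ j = u ^ j * exp (- (j * w))"
        by (simp add: power_mult_distrib exp_of_nat_mult[symmetric])
      then have "r * u ^ j + (1 - r) * v ^ j = u ^ j * (r + (1 - r) * exp (- (j * w)))"
        by (simp add: algebra_simps)
      moreover have "ln \<dots> = j * ln u + ln (r + (1 - r) * exp (- (j * w)))"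
        using uv pos by (subst ln_mult_pos) (auto simp: ln_realpow)
      ultimately show ?thesis
        using w by (simp add: D_def \<mu>_def)
    qed
    ultimately show "(\<Sum>J\<in>Pow K. (-1) ^ card J * ln (r * u ^ card J + (1 - r) * v ^ card J)) < 0"
      by (simp add: sum_negf)
  qed
qed

section \<open>Void probabilities of Poisson processes\<close>

lemma sum_Pow_alternating_prod:
  fixes f :: "'a \<Rightarrow> real"
  assumes "finite K"
  shows "(\<Sum>J\<in>Pow K. (-1) ^ card J * (\<Prod>i\<in>J. f i)) = (\<Prod>i\<in>K. 1 - f i)"
proof -
  have "(\<Prod>i\<in>K. 1 - f i) = (\<Prod>i\<in>K. - f i + 1)"
    by simp
  also have "\<dots> = (\<Sum>J\<in>Pow K. (-1) ^ card J * (\<Prod>i\<in>J. f i))"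
    using assms by (subst prod_add) (auto simp: prod_uminus)
  finally show ?thesis by simp
qed

text \<open>By inclusion-exclusion the sum is minus the measure of the intersection of all
  \<open>A i\<close>; this is the integral of the corresponding identity between indicators.\<close>

lemma alternating_measure_hit_nonpos:
  assumes "finite K" "K \<noteq> {}"
    and A: "\<And>i. i \<in> K \<Longrightarrow> A i \<in> sets \<nu>" "\<And>i. i \<in> K \<Longrightarrow> emeasure \<nu> (A i) \<noteq> \<infinity>"
  shows "(\<Sum>J\<in>Pow K. (-1) ^ card J * measure \<nu> (\<Union>i\<in>J. A i)) \<le> 0"
proof -
  have U: "(\<Union>i\<in>J. A i) \<in> sets \<nu>" "emeasure \<nu> (\<Union>i\<in>J. A i) < \<infinity>" if "J \<subseteq> K" for J
  proof -
    have fin: "finite J"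
      using that assms(1) finite_subset by blast
    then show "(\<Union>i\<in>J. A i) \<in> sets \<nu>"
      using that A by auto
    have "emeasure \<nu> (\<Union>i\<in>J. A i) \<le> (\<Sum>i\<in>J. emeasure \<nu> (A i))"
      using that A fin by (intro emeasure_subadditive_finite) auto
    also have "\<dots> < \<infinity>"
      using that A fin by (auto simp: less_top)
    finally show "emeasure \<nu> (\<Union>i\<in>J. A i) < \<infinity>" .
  qed
  have ind: "indicator (\<Union>i\<in>J. A i) x = 1 - (\<Prod>i\<in>J. 1 - indicator (A i) x :: real)" if "J \<subseteq> K" for J x
    using finite_subset[OF that assms(1)] by (cases "x \<in> (\<Union>i\<in>J. A i)") (auto simp: indicator_def)
  have "(\<Sum>J\<in>Pow K. (-1) ^ card J * measure \<nu> (\<Union>i\<in>J. A i))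
      = (\<Sum>J\<in>Pow K. (-1) ^ card J * (\<integral>x. indicator (\<Union>i\<in>J. A i) x \<partial>\<nu>))"
    using U by (intro sum.cong) auto
  also have "\<dots> = (\<integral>x. (\<Sum>J\<in>Pow K. (-1) ^ card J * indicator (\<Union>i\<in>J. A i) x) \<partial>\<nu>)"
    using U assms(1)
    by (subst Bochner_Integration.integral_sum)
      auto
  also have "\<dots> = (\<integral>x. - (\<Prod>i\<in>K. indicator (A i) x) \<partial>\<nu>)"
  proof (rule Bochner_Integration.integral_cong[OF refl])
    fix x
    \<comment> \<open>The constant 1 in each indicator contributes a product of factors
      \<open>1 - 1\<close> over \<open>K\<close>, which is 0 because \<open>K\<close> is
      nonempty.\<close>
    have "(\<Sum>J\<in>Pow K. (-1) ^ card J * indicator (\<Union>i\<in>J. A i) x)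
        = (\<Sum>J\<in>Pow K. (-1) ^ card J * (\<Prod>i\<in>J. 1 :: real))
          - (\<Sum>J\<in>Pow K. (-1) ^ card J * (\<Prod>i\<in>J. 1 - indicator (A i) x))"
      unfolding sum_subtractf[symmetric] by (intro sum.cong) (auto simp: ind algebra_simps)
    also have "\<dots> = - (\<Prod>i\<in>K. indicator (A i) x)"
      unfolding sum_Pow_alternating_prod[OF assms(1)] using assms by (simp add: card_gt_0_iff)
    finally show "(\<Sum>J\<in>Pow K. (-1) ^ card J * indicator (\<Union>i\<in>J. A i) x)
        = - (\<Prod>i\<in>K. indicator (A i) x :: real)" .
  qed
  also have "\<dots> \<le> 0"
    by (simp add: prod_nonneg)
  finally show ?thesis .
qed

lemma space_nonempty_powerset_space: "space (nonempty_powerset_space S) = Pow S - {{}}"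
  by (auto simp: nonempty_powerset_space_def powerset_space_def space_restrict_space)

lemma sets_contains_point:
  assumes "i \<in> S"
  shows "{B \<in> Pow S - {{}}. i \<in> B} \<in> sets (nonempty_powerset_space S)"
proof -
  have "(\<lambda>B. \<lambda>i\<in>S. i \<in> B) \<in> measurable (powerset_space S) (cube S)"
    unfolding powerset_space_def by (rule measurable_vimage_algebra1) (auto simp: space_PiM)
  from measurable_compose[OF this measurable_component_singleton[OF assms]]
  have "(\<lambda>B. (\<lambda>i\<in>S. i \<in> B) i) \<in> measurable (powerset_space S) (count_space UNIV)" .
  from measurable_sets[OF this, of "{True}"] assms
  have "{B \<in> Pow S. i \<in> B} \<in> sets (powerset_space S)"
    by (auto simp: powerset_space_def vimage_def Int_def conj_commute)
  then have "{B \<in> Pow S. i \<in> B} \<inter> (Pow S - {{}}) \<in> sets (nonempty_powerset_space S)"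
    unfolding nonempty_powerset_space_def by (auto simp: sets_restrict_space Int_commute)
  moreover have "{B \<in> Pow S. i \<in> B} \<inter> (Pow S - {{}}) = {B \<in> Pow S - {{}}. i \<in> B}"
    by auto
  ultimately show ?thesis by simp
qed

text \<open>Membership in \<open>class_R\<close> equates laws of processes on different probability
  spaces, so their vacancy probabilities are compared through a cylinder event of the common
  law.\<close>

lemma process_law_vacant:
  assumes X: "\<And>i. i \<in> S \<Longrightarrow> X i \<in> measurable M (count_space UNIV)" and J: "finite J" "J \<subseteq> S"
  shows "measure (process_law S M X) {f \<in> space (cube S). \<forall>i\<in>J. \<not> f i}
    = measure M {\<omega> \<in> space M. \<forall>i\<in>J. \<not> X i \<omega>}"
proof -
  have "(\<lambda>\<omega>. \<lambda>i\<in>S. X i \<omega>) \<in> measurable M (cube S)"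
    using X by (rule measurable_restrict)
  moreover have "{f \<in> space (cube S). \<forall>i\<in>J. \<not> f i} \<in> sets (cube S)"
  proof (rule sets.sets_Collect_finite_All[OF _ J(1)])
    fix i assume "i \<in> J"
    then have "(\<lambda>f. f i) \<in> measurable (cube S) (count_space UNIV)"
      using J by (intro measurable_component_singleton) auto
    from measurable_sets[OF this, of "{False}"]
    show "{f \<in> space (cube S). \<not> f i} \<in> sets (cube S)"
      by (simp add: vimage_def Int_def conj_commute)
  qed
  ultimately show ?thesis
    unfolding process_law_def using J
    by (subst measure_distr) (auto simp: space_PiM intro!: arg_cong[where f = "measure M"])
qed

text \<open>Having no point in \<open>A\<close> means that the count is 0: the Poisson weight at 0
  for finite intensity, a null event for infinite intensity.\<close>

lemma poisson_process_void:
  assumes "poisson_process M \<nu> I B" and A: "A \<in> sets \<nu>"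
  shows "if emeasure \<nu> A = \<infinity> then measure M {\<omega> \<in> space M. \<forall>j\<in>I \<omega>. B j \<omega> \<notin> A} = 0
    else measure M {\<omega> \<in> space M. \<forall>j\<in>I \<omega>. B j \<omega> \<notin> A} = exp (- measure \<nu> A)"
proof -
  interpret prob_space M
    using assms by (simp add: poisson_process_def)
  have dist: "has_poisson_distribution M (point_count I B A) (emeasure \<nu> A)"
    and meas: "point_count I B A \<in> borel_measurable M"
    using assms by (auto simp: poisson_process_def)
  have eq: "{\<omega> \<in> space M. \<forall>j\<in>I \<omega>. B j \<omega> \<notin> A} = {\<omega> \<in> space M. point_count I B A \<omega> = of_nat 0}"
    by (auto simp: point_count_def emeasure_count_space_eq_0)
  show ?thesis
  proof (cases "emeasure \<nu> A = \<infinity>")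
    case True
    then have "AE \<omega> in M. point_count I B A \<omega> = \<infinity>"
      using dist by (simp add: has_poisson_distribution_def)
    then have "AE \<omega> in M. \<not> point_count I B A \<omega> = of_nat 0"
      by eventually_elim simp
    then have "measure M {\<omega> \<in> space M. point_count I B A \<omega> = of_nat 0} = 0"
      using meas by (subst prob_Collect_eq_0) auto
    then show ?thesis
      unfolding eq by (simp add: True)
  next
    case False
    then have "measure M {\<omega> \<in> space M. point_count I B A \<omega> = of_nat 0}
        = enn2real (emeasure \<nu> A) ^ 0 / fact 0 * exp (- enn2real (emeasure \<nu> A))"
      using dist unfolding has_poisson_distribution_def by metis
    then show ?thesis
      unfolding eq using False by (simp add: measure_def)
  qed
qed

lemma class_R_alternating_log_nonneg:
  fixes X :: "'v \<Rightarrow> 'a \<Rightarrow> bool"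
  assumes R: "process_law S M X \<in> class_R TYPE('w) S"
    and X: "\<And>i. i \<in> S \<Longrightarrow> X i \<in> measurable M (count_space UNIV)"
    and K: "finite K" "K \<subseteq> S" "K \<noteq> {}"
    and pos: "\<And>J. J \<subseteq> K \<Longrightarrow> 0 < measure M {\<omega> \<in> space M. \<forall>i\<in>J. \<not> X i \<omega>}"
  shows "0 \<le> (\<Sum>J\<in>Pow K. (-1) ^ card J * ln (measure M {\<omega> \<in> space M. \<forall>i\<in>J. \<not> X i \<omega>}))"
proof -
  obtain \<nu> :: "'v set measure" and N :: "'w measure" and I B where
    sets: "sets \<nu> = sets (nonempty_powerset_space S)" and P: "poisson_process N \<nu> I B"
    and law: "process_law S M X = process_law S N (covered I B)"
    using R unfolding class_R_def by blast
  define A where "A i = {B \<in> Pow S - {{}}. i \<in> B}" for i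
  have A: "A i \<in> sets \<nu>" if "i \<in> S" for i
    using sets_contains_point[OF that] by (simp add: A_def sets)
  have space: "B j \<omega> \<in> Pow S - {{}}" if "\<omega> \<in> space N" "j \<in> I \<omega>" for \<omega> j
    using P that sets_eq_imp_space_eq[OF sets] by (auto simp: poisson_process_def space_nonempty_powerset_space)
  \<comment> \<open>Measurability of the covering comes from the counts: \<open>i\<close> is covered
    exactly when some point falls into \<open>A i\<close>.\<close>
  have cov: "covered I B i \<in> measurable N (count_space UNIV)" if "i \<in> S" for i
  proof -
    have [measurable]: "point_count I B (A i) \<in> borel_measurable N"
      using P A[OF that] by (auto simp: poisson_process_def)
    have "covered I B i \<omega> \<longleftrightarrow> point_count I B (A i) \<omega> \<noteq> 0" if "\<omega> \<in> space N" for \<omega>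
      using space[OF that] by (auto simp: covered_def point_count_def emeasure_count_space_eq_0 A_def)
    then show ?thesis
      by (subst measurable_cong[of _ _ "\<lambda>\<omega>. point_count I B (A i) \<omega> \<noteq> 0"]) auto
  qed
  have void: "measure M {\<omega> \<in> space M. \<forall>i\<in>J. \<not> X i \<omega>}
      = measure N {\<omega> \<in> space N. \<forall>j\<in>I \<omega>. B j \<omega> \<notin> (\<Union>i\<in>J. A i)}" if "J \<subseteq> K" for J
  proof -
    have J: "finite J" "J \<subseteq> S"
      using that K finite_subset by auto
    have "measure M {\<omega> \<in> space M. \<forall>i\<in>J. \<not> X i \<omega>}
        = measure N {\<omega> \<in> space N. \<forall>i\<in>J. \<not> covered I B i \<omega>}"
      using process_law_vacant[of S X M J] process_law_vacant[of S "covered I B" N J] X cov J law by simp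
    also have "{\<omega> \<in> space N. \<forall>i\<in>J. \<not> covered I B i \<omega>}
        = {\<omega> \<in> space N. \<forall>j\<in>I \<omega>. B j \<omega> \<notin> (\<Union>i\<in>J. A i)}"
      using space by (auto simp: covered_def A_def)
    finally show ?thesis .
  qed
  have U: "(\<Union>i\<in>J. A i) \<in> sets \<nu>" if "J \<subseteq> K" for J
    using that K A finite_subset[of J K] by (intro sets.finite_UN) auto
  \<comment> \<open>An infinite measure would make the vacancy probability 0, against its
    positivity; so the finite case of the void formula applies and its logarithm can be
    taken.\<close>
  have fin: "emeasure \<nu> (\<Union>i\<in>J. A i) \<noteq> \<infinity>"
    and ln: "ln (measure M {\<omega> \<in> space M. \<forall>i\<in>J. \<not> X i \<omega>}) = - measure \<nu> (\<Union>i\<in>J. A i)"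
    if "J \<subseteq> K" for J
    using poisson_process_void[OF P U[OF that]] pos[OF that] void[OF that] by (auto split: if_splits)
  have "(\<Sum>J\<in>Pow K. (-1) ^ card J * measure \<nu> (\<Union>i\<in>J. A i)) \<le> 0"
    using K A fin[of "{_}"] by (intro alternating_measure_hit_nonpos) auto
  then show ?thesis
    using ln by (simp add: sum_negf cong: sum.cong_simp)
qed

section \<open>Connected sets in trees\<close>

lemma connected_on_insert:
  assumes "simple_graph V E" "connected_on E F" "i \<in> F" "E i j"
  shows "connected_on E (insert j F)"
proof -
  let ?R = "\<lambda>a b. E a b \<and> a \<in> insert j F \<and> b \<in> insert j F"
  have F: "?R\<^sup>*\<^sup>* u v" if "u \<in> F" "v \<in> F" for u v
  proof -
    have "(\<lambda>a b. E a b \<and> a \<in> F \<and> b \<in> F)\<^sup>*\<^sup>* u v"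
      using assms(2) that by (auto simp: connected_on_def)
    then show ?thesis
      by (rule rtranclp_mono[THEN predicate2D, rotated]) auto
  qed
  have ij: "?R i j" "?R j i"
    using assms by (auto simp: simple_graph_def)
  have "?R\<^sup>*\<^sup>* u i" "?R\<^sup>*\<^sup>* i u" if "u \<in> insert j F" for u
    using that F[of u i] F[of i u] ij assms(3) by auto
  then show ?thesis
    unfolding connected_on_def by (blast intro: rtranclp_trans)
qed

lemma connected_on_path:
  assumes "simple_graph V E" "connected_on E F" "g 0 \<in> F" "\<And>n. E (g n) (g (Suc n))"
  shows "connected_on E (F \<union> g ` {1..n :: nat})"
proof (induction n)
  case 0
  then show ?case using assms by simp
next
  case (Suc n)
  have "g n \<in> F \<union> g ` {1..n}"
    using assms(3) by (cases n) auto
  from connected_on_insert[OF assms(1) Suc this assms(4)]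
  show ?case
    by (simp add: atLeastAtMostSuc_conv)
qed

lemma rtranclp_exit:
  assumes "R\<^sup>*\<^sup>* a b" "a \<in> G" "b \<notin> G"
  obtains i j where "R i j" "i \<in> G" "j \<notin> G"
  using assms by (induction rule: rtranclp_induct) auto

text \<open>A finite connected set grows from any of its vertices by adding adjacent vertices
  through connected subsets: a maximal set reached this way is all of \<open>F\<close>, since
  otherwise a walk inside \<open>F\<close> would leave it along an edge.\<close>

lemma connected_on_induct [consumes 4, case_names base step]:
  assumes "finite F" "connected_on E F" "b \<in> F"
    and graph: "simple_graph V E"
    and base: "P {b}"
    and step: "\<And>G i j. G \<subseteq> F \<Longrightarrow> b \<in> G \<Longrightarrow> connected_on E G \<Longrightarrow> i \<in> G \<Longrightarrow> j \<in> F - G \<Longrightarrow> E i j \<Longrightarrow> P G \<Longrightarrow>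
      P (insert j G)"
  shows "P F"
proof -
  define \<G> where "\<G> = {G. G \<subseteq> F \<and> b \<in> G \<and> connected_on E G \<and> P G}"
  have "finite \<G>" "{b} \<in> \<G>"
    using assms by (auto simp: \<G>_def connected_on_def)
  then obtain G where G: "G \<in> \<G>" and max: "\<And>H. H \<in> \<G> \<Longrightarrow> G \<subseteq> H \<Longrightarrow> G = H"
    using finite_has_maximal[of \<G>] by blast
  have "G = F"
  proof (rule ccontr)
    assume "G \<noteq> F"
    then obtain v where v: "v \<in> F" "v \<notin> G"
      using G by (auto simp: \<G>_def)
    have "(\<lambda>a b. E a b \<and> a \<in> F \<and> b \<in> F)\<^sup>*\<^sup>* b v"
      using assms v by (auto simp: connected_on_def)
    then obtain i j where "E i j" "j \<in> F" "i \<in> G" "j \<notin> G"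
      by (rule rtranclp_exit[of _ b v G]) (use v G in \<open>auto simp: \<G>_def\<close>)
    then have "insert j G \<in> \<G>"
      using G step[of G i j] connected_on_insert[OF graph] by (auto simp: \<G>_def)
    with max \<open>j \<notin> G\<close> show False by blast
  qed
  with G show ?thesis
    by (auto simp: \<G>_def)
qed

lemma rtranclp_distinct_path:
  assumes "R\<^sup>*\<^sup>* a b"
  shows "\<exists>xs. xs \<noteq> [] \<and> distinct xs \<and> successively R xs \<and> hd xs = a \<and> last xs = b"
  using assms
proof (induction rule: rtranclp_induct)
  case base
  show ?case by (intro exI[of _ "[a]"]) simp
next
  case (step b c)
  then obtain xs where xs: "xs \<noteq> []" "distinct xs" "successively R xs" "hd xs = a" "last xs = b"
    by blast
  show ?case
  proof (cases "c \<in> set xs")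
    case False
    with xs step show ?thesis
      by (intro exI[of _ "xs @ [c]"]) (auto simp: successively_append_iff)
  next
    \<comment> \<open>The walk returns to \<open>c\<close>, so the loop is erased by cutting the
      path at that vertex.\<close>
    case True
    then obtain ys zs where "xs = ys @ c # zs"
      by (meson split_list)
    with xs show ?thesis
      by (intro exI[of _ "ys @ [c]"]) (auto simp: successively_append_iff hd_append)
  qed
qed

text \<open>A path inside \<open>F\<close> between two different neighbours of \<open>j\<close>
  would close up to a cycle through \<open>j\<close>.\<close>

lemma tree_unique_neighbour:
  assumes tree: "is_tree V E" and F: "connected_on E F" "i \<in> F" "i' \<in> F" "j \<notin> F"
    and ij: "E i j" "E i' j"
  shows "i = i'"
proof (rule ccontr)
  assume "i \<noteq> i'"
  let ?R = "\<lambda>a b. E a b \<and> a \<in> F \<and> b \<in> F"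
  obtain xs where xs: "xs \<noteq> []" "distinct xs" "successively ?R xs" "hd xs = i" "last xs = i'"
    using rtranclp_distinct_path[of ?R i i'] F by (auto simp: connected_on_def)
  obtain y ys where ys: "xs = i # y # ys"
    using xs \<open>i \<noteq> i'\<close> by (cases xs; cases "tl xs") auto
  \<comment> \<open>With at least two vertices, each one lies on an edge of the restricted relation
    and hence in \<open>F\<close>; a single vertex would not be constrained.\<close>
  have "set zs \<subseteq> F" if "successively ?R zs" "length zs \<ge> 2" for zs
    using that
  proof (induction zs rule: induct_list012)
    case (3 x y zs)
    then show ?case by (cases zs) auto
  qed auto
  from this[OF xs(3)] have "j \<notin> set xs"
    using F by (auto simp: ys)
  moreover have "successively E xs"
    using xs(3) by (rule successively_mono) auto
  moreover have "E j i" "2 \<le> length xs"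
    using tree ij(1) by (auto simp: is_tree_def simple_graph_def ys)
  ultimately have "graph_cycle E (xs @ [j])"
    unfolding graph_cycle_def using xs ij(2) by (simp add: successively_append_iff)
  then show False
    using tree by (auto simp: is_tree_def)
qed

section \<open>Changing the root and star-shaped marginals\<close>

lemma pmf_markov_step:
  assumes "0 \<le> p" "p \<le> 1"
  shows "pmf (markov_step p r a) b = (1 - p) * of_bool (a = b) + p * pmf (bernoulli_pmf (1 - r)) b"
  using assms by (simp add: markov_step_def pmf_bind indicator_def mult.commute)

locale tree_process = prob_space M for M :: "'a measure" +
  fixes V :: "'v set" and E :: "'v \<Rightarrow> 'v \<Rightarrow> bool" and p r :: real and X :: "'v \<Rightarrow> 'a \<Rightarrow> bool"
  assumes tree: "is_tree V E" and p: "0 < p" "p < 1" and r: "0 < r" "r < 1"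
    and X_measurable: "\<And>i. i \<in> V \<Longrightarrow> X i \<in> measurable M (count_space UNIV)"
begin

lemma graph: "simple_graph V E"
  using tree by (simp add: is_tree_def)

lemma edge_in: "E i j \<Longrightarrow> i \<in> V" "E i j \<Longrightarrow> j \<in> V" "E i j \<Longrightarrow> E j i"
  using graph by (auto simp: simple_graph_def)

abbreviation stationary :: "bool \<Rightarrow> real" where
  "stationary b \<equiv> pmf (bernoulli_pmf (1 - r)) b"

abbreviation transition :: "bool \<Rightarrow> bool \<Rightarrow> real" where
  "transition a b \<equiv> pmf (markov_step p r a) b"

definition cyl :: "'v set \<Rightarrow> ('v \<Rightarrow> bool) \<Rightarrow> 'a set" where
  "cyl F x = {\<omega> \<in> space M. \<forall>k\<in>F. X k \<omega> = x k}"

text \<open>The Markov property as a predicate of the root, separate from the locale assumptions, so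
  that the root can be moved while the process stays fixed.\<close>

definition rooted_chain :: "'v \<Rightarrow> bool" where
  "rooted_chain \<rho> \<longleftrightarrow> \<rho> \<in> V \<and> (\<forall>b. prob (cyl {\<rho>} (\<lambda>_. b)) = stationary b) \<and>
     (\<forall>F i j x. finite F \<longrightarrow> F \<subseteq> V \<longrightarrow> \<rho> \<in> F \<longrightarrow> connected_on E F \<longrightarrow> i \<in> F \<longrightarrow> j \<notin> F \<longrightarrow> E i j \<longrightarrow>
        prob (cyl (insert j F) x) = prob (cyl F x) * transition (x i) (x j))"

lemma transition_eq: "transition a b = (1 - p) * of_bool (a = b) + p * stationary b"
  using p by (simp add: pmf_markov_step)

lemma transition_sum: "transition a True + transition a False = 1"
  using r by (cases a) (simp_all add: transition_eq algebra_simps)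

lemma transition_reversible: "stationary a * transition a b = stationary b * transition b a"
  by (auto simp: transition_eq)

lemma event_eq: "i \<in> V \<Longrightarrow> {\<omega> \<in> space M. X i \<omega> = b} \<in> events"
  using measurable_sets[OF X_measurable, of i "{b}"] by (simp add: vimage_def Int_def conj_commute)

lemma cyl_events:
  assumes "finite F" "F \<subseteq> V"
  shows "cyl F x \<in> events"
  unfolding cyl_def using assms event_eq by (intro sets.sets_Collect_finite_All) auto

lemma cyl_cong: "(\<And>k. k \<in> F \<Longrightarrow> x k = y k) \<Longrightarrow> cyl F x = cyl F y"
  by (auto simp: cyl_def)

lemma cyl_insert_upd: "j \<notin> F \<Longrightarrow> cyl (insert j F) (x(j := b)) = cyl F x \<inter> {\<omega> \<in> space M. X j \<omega> = b}"
  by (auto simp: cyl_def)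

lemma prob_split:
  assumes "A \<in> events" "j \<in> V"
  shows "prob A = prob (A \<inter> {\<omega> \<in> space M. X j \<omega> = True}) + prob (A \<inter> {\<omega> \<in> space M. X j \<omega> = False})"
proof -
  have "A = (A \<inter> {\<omega> \<in> space M. X j \<omega> = True}) \<union> (A \<inter> {\<omega> \<in> space M. X j \<omega> = False})"
    (is "_ = ?T \<union> ?F")
    using sets.sets_into_space[OF assms(1)] by auto
  moreover have "prob (?T \<union> ?F) = prob ?T + prob ?F"
    by (intro finite_measure_Union sets.Int assms event_eq) auto
  ultimately show ?thesis by simp
qed

lemma prob_cyl_split:
  assumes "finite F" "F \<subseteq> V" "j \<in> V" "j \<notin> F"
  shows "prob (cyl F x) = prob (cyl (insert j F) (x(j := True))) + prob (cyl (insert j F) (x(j := False)))"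
  unfolding cyl_insert_upd[OF assms(4)] using assms by (intro prob_split cyl_events)

section \<open>Independence of the law from the choice of the root\<close>

lemma rooted_chain_step:
  assumes "rooted_chain \<rho>" "finite F" "F \<subseteq> V" "\<rho> \<in> F" "connected_on E F" "i \<in> F" "j \<notin> F" "E i j"
  shows "prob (cyl (insert j F) x) = prob (cyl F x) * transition (x i) (x j)"
  using assms(1)[unfolded rooted_chain_def, THEN conjunct2, THEN conjunct2, rule_format, OF assms(2-8)] .

lemma rooted_chain_root:
  assumes "rooted_chain \<rho>"
  shows "prob (cyl {\<rho>} x) = stationary (x \<rho>)"
proof -
  have "cyl {\<rho>} x = cyl {\<rho>} (\<lambda>_. x \<rho>)"
    by (rule cyl_cong) simp
  then show ?thesis
    using assms by (simp add: rooted_chain_def)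
qed

lemma rooted_chain_in: "rooted_chain \<rho> \<Longrightarrow> \<rho> \<in> V"
  unfolding rooted_chain_def by (rule conjunct1)

text \<open>Reversibility lets the joint law on the edge be read from \<open>\<sigma>\<close>
  instead of \<open>\<rho>\<close>; summing over the value at \<open>\<rho>\<close> gives the
  marginal at \<open>\<sigma>\<close>.\<close>

lemma rooted_chain_edge:
  assumes \<rho>: "rooted_chain \<rho>" and e: "E \<rho> \<sigma>"
  shows "prob (cyl {\<rho>, \<sigma>} x) = stationary (x \<sigma>) * transition (x \<sigma>) (x \<rho>)"
    and "prob (cyl {\<sigma>} x) = stationary (x \<sigma>)"
proof -
  have neq: "\<rho> \<noteq> \<sigma>"
    using e graph by (auto simp: simple_graph_def)
  have pair: "prob (cyl {\<rho>, \<sigma>} y) = stationary (y \<sigma>) * transition (y \<sigma>) (y \<rho>)" for y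
  proof -
    have "prob (cyl {\<sigma>, \<rho>} y) = stationary (y \<rho>) * transition (y \<rho>) (y \<sigma>)"
      using rooted_chain_step[OF \<rho>, of "{\<rho>}" \<rho> \<sigma> y] rooted_chain_root[OF \<rho>, of y] e edge_in[OF e] neq
      by (simp add: connected_on_def)
    then show ?thesis
      by (subst transition_reversible) (simp add: insert_commute)
  qed
  then show "prob (cyl {\<rho>, \<sigma>} x) = stationary (x \<sigma>) * transition (x \<sigma>) (x \<rho>)" .
  have "prob (cyl {\<sigma>} x) = stationary (x \<sigma>) * (transition (x \<sigma>) True + transition (x \<sigma>) False)"
    using prob_cyl_split[of "{\<sigma>}" \<rho> x] edge_in[OF e] neq by (simp add: pair distrib_left)
  then show "prob (cyl {\<sigma>} x) = stationary (x \<sigma>)"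
    by (simp add: transition_sum)
qed

text \<open>The Markov step is known only for sets containing \<open>\<rho>\<close>. So
  \<open>F\<close> is grown from \<open>\<sigma>\<close> with \<open>\<rho>\<close> attached at
  every stage, starting from the reversed edge.\<close>

lemma rooted_chain_reverse_edge:
  assumes \<rho>: "rooted_chain \<rho>" and e: "E \<rho> \<sigma>"
    and F: "finite F" "F \<subseteq> V" "connected_on E F" "\<sigma> \<in> F" "\<rho> \<notin> F"
  shows "prob (cyl (insert \<rho> F) x) = prob (cyl F x) * transition (x \<sigma>) (x \<rho>)"
  using F(1,3,4) graph
proof (induction arbitrary: x rule: connected_on_induct)
  case base
  show ?case
    by (simp add: rooted_chain_edge[OF \<rho> e])
next
  case (step G i j)
  have G: "finite G" "G \<subseteq> V" "\<rho> \<notin> G" "j \<noteq> \<rho>" "j \<in> V"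
    using step F finite_subset by auto
  have "connected_on E (insert \<rho> G)"
    using step e edge_in by (intro connected_on_insert[OF graph, of _ \<sigma>]) auto
  then have eq: "prob (cyl (insert \<rho> (insert j G)) y) =
      prob (cyl G y) * transition (y \<sigma>) (y \<rho>) * transition (y i) (y j)" for y
    using rooted_chain_step[OF \<rho>, of "insert \<rho> G" i j y] G step edge_in[OF e]
    by (simp add: insert_commute step.IH)
  \<comment> \<open>Summing out the value at \<open>\<rho>\<close> gives the Markov step for
    \<open>G\<close> itself, because the transition probabilities from \<open>\<sigma>\<close> add
    up to 1.\<close>
  have "prob (cyl (insert j G) x) = prob (cyl G x) * transition (x i) (x j)"
  proof -
    have "cyl G (x(\<rho> := b)) = cyl G x" for b
      using G by (intro cyl_cong) auto
    moreover have "\<sigma> \<noteq> \<rho>" "i \<noteq> \<rho>" "j \<noteq> \<rho>"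
      using step G by auto
    ultimately have "prob (cyl (insert j G) x) = prob (cyl G x) * transition (x i) (x j) *
        (transition (x \<sigma>) True + transition (x \<sigma>) False)"
      using prob_cyl_split[of "insert j G" \<rho> x] G edge_in[OF e] by (simp add: eq algebra_simps)
    then show ?thesis
      by (simp add: transition_sum)
  qed
  then show ?case
    by (simp add: eq)
qed

text \<open>Sets containing \<open>\<rho>\<close> are covered by the old root. If the new vertex is
  \<open>\<rho>\<close>, absence of cycles forces \<open>i = \<sigma>\<close> and the edge is
  reversed. Otherwise \<open>\<rho>\<close> is attached to \<open>F\<close> and its value summed
  out.\<close>

lemma rooted_chain_adjacent:
  assumes \<rho>: "rooted_chain \<rho>" and e: "E \<rho> \<sigma>"
  shows "rooted_chain \<sigma>"
  unfolding rooted_chain_def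
proof (intro conjI allI impI)
  show "\<sigma> \<in> V"
    using e edge_in by blast
  show "prob (cyl {\<sigma>} (\<lambda>_. b)) = stationary b" for b
    by (simp add: rooted_chain_edge[OF \<rho> e])
  fix F i j x
  assume F: "finite F" "F \<subseteq> V" "\<sigma> \<in> F" "connected_on E F" "i \<in> F" "j \<notin> F" "E i j"
  have jV: "j \<in> V"
    using F edge_in by blast
  show "prob (cyl (insert j F) x) = prob (cyl F x) * transition (x i) (x j)"
  proof (cases "\<rho> \<in> F")
    case True
    then show ?thesis
      using rooted_chain_step[OF \<rho>] F by blast
  next
    case \<rho>F: False
    show ?thesis
    proof (cases "j = \<rho>")
      case True
      then have "i = \<sigma>"
        using tree_unique_neighbour[OF tree F(4), of i \<sigma> j] F e edge_in by auto
      then show ?thesis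
        using rooted_chain_reverse_edge[OF \<rho> e] F True by simp
    next
      case False
      have "connected_on E (insert \<rho> F)"
        using F e edge_in by (intro connected_on_insert[OF graph, of _ \<sigma>]) auto
      then have eq: "prob (cyl (insert \<rho> (insert j F)) y) =
          prob (cyl (insert \<rho> F) y) * transition (y i) (y j)" for y
        using rooted_chain_step[OF \<rho>, of "insert \<rho> F" i j y] F False edge_in[OF e]
        by (simp add: insert_commute)
      have "i \<noteq> \<rho>"
        using F \<rho>F by auto
      then show ?thesis
        using prob_cyl_split[of "insert j F" \<rho> x] prob_cyl_split[of F \<rho> x] F \<rho>F False edge_in[OF e] jV
        by (simp add: eq algebra_simps)
    qed
  qed
qed

lemma rooted_chain_any_root:
  assumes "rooted_chain \<rho>" "\<sigma> \<in> V"
  shows "rooted_chain \<sigma>"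
proof -
  have "(\<lambda>a b. E a b \<and> a \<in> V \<and> b \<in> V)\<^sup>*\<^sup>* \<rho> \<sigma>"
    using tree[unfolded is_tree_def connected_on_def] rooted_chain_in[OF assms(1)] assms(2) by blast
  then show ?thesis
  proof (induction rule: rtranclp_induct)
    case (step \<sigma> \<tau>)
    then show ?case using rooted_chain_adjacent[OF step.IH] by simp
  qed (rule assms(1))
qed

section \<open>Conditional independence along disjoint paths\<close>

text \<open>Closed form of the \<open>n\<close>-step transition probabilities: with probability
  \<open>(1 - p) ^ n\<close> no step resamples, and otherwise the value is stationary.\<close>

definition transition_n :: "nat \<Rightarrow> bool \<Rightarrow> bool \<Rightarrow> real" where
  "transition_n n a b = (1 - p) ^ n * of_bool (a = b) + (1 - (1 - p) ^ n) * stationary b"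

lemma transition_n_Suc:
  "transition_n (Suc n) a b = transition a True * transition_n n True b + transition a False * transition_n n False b"
  using r by (cases a; cases b) (simp_all add: transition_n_def transition_eq, simp_all add: algebra_simps)

text \<open>Given the values on \<open>F\<close>, the end of a path leaving \<open>F\<close> is
  independent of \<open>A\<close>. The number \<open>h\<close> is the conditional probability of
  \<open>A\<close>, unchanged when the values on the path are revealed; it must serve all extensions
  \<open>y\<close> of \<open>x\<close> along the path, since these are summed out.\<close>

lemma prob_path_end:
  assumes \<rho>: "rooted_chain \<rho>"
    and F: "finite F" "F \<subseteq> V" "connected_on E F" "\<rho> \<in> F"
    and g: "g 0 \<in> F" "\<And>n. E (g n) (g (Suc n))" "inj g" "\<And>j. j \<in> {1..n} \<Longrightarrow> g j \<notin> F"
    and A: "A \<in> events"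
    and h: "\<And>y. (\<And>k. k \<in> F \<Longrightarrow> y k = x k) \<Longrightarrow>
        prob (cyl (F \<union> g ` {1..n}) y \<inter> A) = prob (cyl (F \<union> g ` {1..n}) y) * h"
  shows "prob (cyl F x \<inter> A \<inter> {\<omega> \<in> space M. X (g n) \<omega> = b})
    = prob (cyl F x) * transition_n n (x (g 0)) b * h"
  using F g h
proof (induction n arbitrary: F g x)
  case 0
  have "prob (cyl F x \<inter> A) = prob (cyl F x) * h"
    using "0.prems"(9)[of x] by simp
  moreover have "cyl F x \<inter> A \<inter> {\<omega> \<in> space M. X (g 0) \<omega> = b} = (if x (g 0) = b then cyl F x \<inter> A else {})"
    using "0.prems"(5) by (auto simp: cyl_def)
  ultimately show ?case
    by (simp add: transition_n_def)
next
  case (Suc n)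
  let ?F = "insert (g 1) F"
  have g1: "g 1 \<notin> F" "E (g 0) (g 1)" "g 1 \<in> V"
    using Suc.prems(6)[of 0] Suc.prems(8)[of 1] edge_in by auto
  have un: "?F \<union> (\<lambda>m. g (Suc m)) ` {1..n} = F \<union> g ` {1..Suc n}"
  proof -
    have "{1..Suc n} = insert 1 (Suc ` {1..n})"
      by auto
    then show ?thesis
      by (simp only: image_insert image_image Un_insert_left Un_insert_right)
  qed
  \<comment> \<open>The first vertex of the path joins the known set with value \<open>c\<close>,
    which leaves a path of \<open>n\<close> steps.\<close>
  have "prob (cyl ?F (x(g 1 := c)) \<inter> A \<inter> {\<omega> \<in> space M. X (g (Suc n)) \<omega> = b})
      = prob (cyl ?F (x(g 1 := c))) * transition_n n ((x(g 1 := c)) (g (Suc 0))) b * h" for c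
  proof (rule Suc.IH[of ?F "\<lambda>m. g (Suc m)"])
    show "connected_on E ?F"
      using Suc.prems g1 by (intro connected_on_insert[OF graph])
    show "inj (\<lambda>m. g (Suc m))"
      using Suc.prems(7) by (auto simp: inj_on_def)
    show "g (Suc j) \<notin> ?F" if "j \<in> {1..n}" for j
      using that Suc.prems(8)[of "Suc j"] Suc.prems(7) by (auto simp: inj_eq)
    show "prob (cyl (?F \<union> (\<lambda>m. g (Suc m)) ` {1..n}) y \<inter> A) = prob (cyl (?F \<union> (\<lambda>m. g (Suc m)) ` {1..n}) y) * h"
      if "\<And>k. k \<in> ?F \<Longrightarrow> y k = (x(g 1 := c)) k" for y
      unfolding un using that g1 by (intro Suc.prems(9)) auto
  qed (use Suc.prems g1 in auto)
  moreover have "prob (cyl ?F (x(g 1 := c))) = prob (cyl F x) * transition (x (g 0)) c" for c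
  proof -
    have "cyl F (x(g 1 := c)) = cyl F x"
      using g1 by (intro cyl_cong) auto
    moreover have "g 0 \<noteq> g 1"
      using g1 Suc.prems by auto
    ultimately show ?thesis
      using rooted_chain_step[OF \<rho>, of F "g 0" "g 1" "x(g 1 := c)"] Suc.prems g1 by simp
  qed
  ultimately have eq: "prob (cyl F x \<inter> A \<inter> {\<omega> \<in> space M. X (g (Suc n)) \<omega> = b} \<inter> {\<omega> \<in> space M. X (g 1) \<omega> = c})
      = prob (cyl F x) * transition (x (g 0)) c * transition_n n c b * h" for c
    by (simp add: cyl_insert_upd[OF g1(1)[unfolded One_nat_def]] Int_ac)
  \<comment> \<open>Summing over the value at the first vertex is the Chapman-Kolmogorov equation
    \<open>transition_n_Suc\<close>.\<close>
  have "cyl F x \<inter> A \<inter> {\<omega> \<in> space M. X (g (Suc n)) \<omega> = b} \<in> events"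
    using Suc.prems A edge_in by (intro sets.Int cyl_events event_eq) blast+
  from prob_split[OF this g1(3)] show ?case
    by (simp only: eq transition_n_Suc) (simp add: algebra_simps)
qed

text \<open>Paths are split off one at a time. The induction hypothesis for the other paths, applied
  to \<open>F\<close> enlarged by the whole segment of path \<open>l\<close>, supplies the constant
  conditional probability that \<open>prob_path_end\<close> requires; this is why \<open>F\<close>
  and \<open>x\<close> vary.\<close>

lemma prob_disjoint_paths_vacant:
  assumes \<rho>: "rooted_chain \<rho>" and "finite J"
    and F: "finite F" "F \<subseteq> V" "connected_on E F" "\<rho> \<in> F"
    and \<gamma>: "\<And>l. l \<in> J \<Longrightarrow> infinite_path_from E \<rho> (\<gamma> l)"
    and disj: "\<And>l j. l \<in> J \<Longrightarrow> j \<in> {1..n} \<Longrightarrow> \<gamma> l j \<notin> F"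
      "\<And>l l' j j'. l \<in> J \<Longrightarrow> l' \<in> J \<Longrightarrow> l \<noteq> l' \<Longrightarrow> j \<in> {1..n} \<Longrightarrow> j' \<in> {1..n} \<Longrightarrow> \<gamma> l j \<noteq> \<gamma> l' j'"
  shows "prob (cyl F x \<inter> {\<omega> \<in> space M. \<forall>l\<in>J. \<not> X (\<gamma> l n) \<omega>})
    = prob (cyl F x) * transition_n n (x \<rho>) False ^ card J"
  using assms(2-)
proof (induction J arbitrary: F x rule: finite_induct)
  case empty
  have "cyl F x \<inter> space M = cyl F x"
    by (auto simp: cyl_def)
  then show ?case by simp
next
  case (insert l J)
  define A where "A = {\<omega> \<in> space M. \<forall>l\<in>J. \<not> X (\<gamma> l n) \<omega>}"
  have path: "\<gamma> i 0 = \<rho>" "E (\<gamma> i m) (\<gamma> i (Suc m))" "inj (\<gamma> i)" if "i \<in> insert l J" for i m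
    using insert.prems(5)[OF that] by (auto simp: infinite_path_from_def)
  have in_V: "\<gamma> i m \<in> V" if "i \<in> insert l J" for i m
    using path(2)[OF that] edge_in by blast
  have "prob (cyl F x \<inter> A \<inter> {\<omega> \<in> space M. X (\<gamma> l n) \<omega> = False})
      = prob (cyl F x) * transition_n n (x (\<gamma> l 0)) False * transition_n n (x \<rho>) False ^ card J"
  proof (rule prob_path_end[OF \<rho> insert.prems(1-4)])
    show "A \<in> events"
      unfolding A_def using event_eq[of _ False] in_V insert.hyps
      by (intro sets.sets_Collect_finite_All) auto
    show "prob (cyl (F \<union> \<gamma> l ` {1..n}) y \<inter> A)
        = prob (cyl (F \<union> \<gamma> l ` {1..n}) y) * transition_n n (x \<rho>) False ^ card J"
      if y: "\<And>k. k \<in> F \<Longrightarrow> y k = x k" for y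
    proof -
      have "prob (cyl (F \<union> \<gamma> l ` {1..n}) y \<inter> A)
          = prob (cyl (F \<union> \<gamma> l ` {1..n}) y) * transition_n n (y \<rho>) False ^ card J"
        unfolding A_def
      proof (rule insert.IH)
        show "connected_on E (F \<union> \<gamma> l ` {1..n})"
          using insert.prems path[of l] by (intro connected_on_path[OF graph]) auto
        show "\<gamma> i j \<notin> F \<union> \<gamma> l ` {1..n}" if "i \<in> J" "j \<in> {1..n}" for i j
        proof -
          have "i \<noteq> l"
            using that insert.hyps by auto
          then show ?thesis
            using insert.prems(6)[of i j] insert.prems(7)[of i l j] that by blast
        qed
      qed (use insert.prems in_V in auto)
      then show ?thesis
        using y[OF insert.prems(4)] by simp
    qed
  qed (use insert.prems path in auto)
  moreover have "cyl F x \<inter> A \<inter> {\<omega> \<in> space M. X (\<gamma> l n) \<omega> = False}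
      = cyl F x \<inter> {\<omega> \<in> space M. \<forall>l\<in>insert l J. \<not> X (\<gamma> l n) \<omega>}"
    by (auto simp: A_def)
  ultimately show ?case
    using path insert.hyps by (simp add: mult_ac)
qed

text \<open>Conditioning on the value at the centre makes the path ends independent; the two bases
  are \<open>transition_n n False False\<close> and
  \<open>transition_n n True False\<close>.\<close>

lemma prob_star_vacant:
  assumes \<rho>: "rooted_chain \<rho>" and J: "finite J"
    and \<gamma>: "\<And>l. l \<in> J \<Longrightarrow> infinite_path_from E \<rho> (\<gamma> l)"
    and disj: "\<And>l l'. l \<in> J \<Longrightarrow> l' \<in> J \<Longrightarrow> l \<noteq> l' \<Longrightarrow> range (\<gamma> l) \<inter> range (\<gamma> l') = {\<rho>}"
  shows "prob {\<omega> \<in> space M. \<forall>l\<in>J. \<not> X (\<gamma> l n) \<omega>}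
    = r * (r + (1 - r) * (1 - p) ^ n) ^ card J + (1 - r) * (r * (1 - (1 - p) ^ n)) ^ card J"
proof -
  let ?A = "{\<omega> \<in> space M. \<forall>l\<in>J. \<not> X (\<gamma> l n) \<omega>}"
  have \<rho>V: "\<rho> \<in> V"
    using \<rho> by (rule rooted_chain_in)
  have path: "\<gamma> i 0 = \<rho>" "E (\<gamma> i m) (\<gamma> i (Suc m))" "inj (\<gamma> i)" if "i \<in> J" for i m
    using \<gamma>[OF that] by (auto simp: infinite_path_from_def)
  have neq: "\<gamma> l j \<noteq> \<rho>" if "l \<in> J" "j \<in> {1..n}" for l j
    using path(1,3)[OF that(1)] that(2) by (metis atLeastAtMost_iff inj_eq not_one_le_zero)
  have "\<gamma> l m \<in> V" if "l \<in> J" for l m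
    using path(2)[OF that] edge_in by blast
  then have A: "?A \<in> events"
    using event_eq[of _ False] J by (intro sets.sets_Collect_finite_All) auto
  have eq: "prob (?A \<inter> {\<omega> \<in> space M. X \<rho> \<omega> = b}) = stationary b * transition_n n b False ^ card J" for b
  proof -
    have "prob (cyl {\<rho>} (\<lambda>_. b) \<inter> ?A) = prob (cyl {\<rho>} (\<lambda>_. b)) * transition_n n b False ^ card J"
    proof (rule prob_disjoint_paths_vacant[OF \<rho> J])
      show "\<gamma> l j \<noteq> \<gamma> l' j'"
        if "l \<in> J" "l' \<in> J" "l \<noteq> l'" "j \<in> {1..n}" "j' \<in> {1..n}" for l l' j j'
        using disj[OF that(1-3)] neq[OF that(1,4)] by (metis IntI rangeI singletonD)
    qed (use \<rho>V neq \<gamma> in \<open>auto simp: connected_on_def\<close>)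
    then show ?thesis
      using rooted_chain_root[OF \<rho>, of "\<lambda>_. b"] by (simp add: cyl_def Int_commute)
  qed
  show ?thesis
    using prob_split[OF A \<rho>V] r unfolding eq by (simp add: transition_n_def algebra_simps)
qed

end

section \<open>The contradiction for path ends far from the centre\<close>

lemma log_ratio_tendsto_0:
  fixes p r :: real
  assumes "0 < p" "p < 1" "0 < r"
  shows "(\<lambda>n. ln ((r + (1 - r) * (1 - p) ^ n) / (r * (1 - (1 - p) ^ n)))) \<longlonglongrightarrow> 0"
proof -
  have "(\<lambda>n. (1 - p) ^ n) \<longlonglongrightarrow> 0"
    using assms by (intro LIMSEQ_power_zero) auto
  then have "(\<lambda>n. ln ((r + (1 - r) * (1 - p) ^ n) / (r * (1 - (1 - p) ^ n))))
      \<longlonglongrightarrow> ln ((r + (1 - r) * 0) / (r * (1 - 0)))"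
    using assms by (intro tendsto_intros) auto
  then show ?thesis
    using assms by simp
qed

lemma (in tree_process) process_law_notin_class_R:
  assumes \<rho>: "rooted_chain \<rho>" and paths: "has_disjoint_infinite_paths E \<rho> d" and d: "3 \<le> d"
    and r2: "r < 1 / (1 - r2 d)"
  shows "process_law V M X \<notin> class_R TYPE('w) V"
proof
  assume R: "process_law V M X \<in> class_R TYPE('w) V"
  obtain m where m: "2 \<le> m" "m < d" "poly (sigmoid_poly m) (1 - r) < 0"
    using sigmoid_poly_neg_of_less_r2[OF d r(1) r2] .
  obtain \<gamma> where \<gamma>: "\<And>k. k < d \<Longrightarrow> infinite_path_from E \<rho> (\<gamma> k)"
    and disj: "\<And>k l. k < d \<Longrightarrow> l < d \<Longrightarrow> k \<noteq> l \<Longrightarrow> range (\<gamma> k) \<inter> range (\<gamma> l) = {\<rho>}"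
    using paths unfolding has_disjoint_infinite_paths_def by blast
  \<comment> \<open>\<open>{..m}\<close> has \<open>m + 1\<close> elements, the order of the
    derivative that \<open>sigmoid_poly m\<close> represents, and \<open>m < d\<close> ensures that
    this many paths exist.\<close>
  obtain \<delta> where \<delta>: "0 < \<delta>" and neg: "\<And>u v. 0 < v \<Longrightarrow> v < u \<Longrightarrow> ln (u / v) < \<delta> \<Longrightarrow>
      (\<Sum>J\<in>Pow {..m}. (-1) ^ card J * ln (r * u ^ card J + (1 - r) * v ^ card J)) < 0"
    using alternating_log_sum_neg[OF r m(1,3), of "{..m}"] by auto
  \<comment> \<open>\<open>u n\<close> and \<open>v n\<close> are the probabilities that a path end
    has value 0 given value 0, respectively 1, at the centre.\<close>
  define u where "u n = r + (1 - r) * (1 - p) ^ n" for n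
  define v where "v n = r * (1 - (1 - p) ^ n)" for n
  \<comment> \<open>Besides a small step, \<open>n \<ge> 1\<close> is required: it makes
    \<open>v n\<close> positive and keeps the path ends away from the common centre, hence
    distinct.\<close>
  have "eventually (\<lambda>n. ln (u n / v n) < \<delta> \<and> 1 \<le> n) sequentially"
    using order_tendstoD(2)[OF log_ratio_tendsto_0[OF p r(1)] \<delta>] eventually_ge_at_top
    unfolding u_def v_def by (rule eventually_conj)
  then obtain n where n: "ln (u n / v n) < \<delta>" "1 \<le> n"
    by (auto simp: eventually_sequentially)
  have "(1 - p) ^ n < 1" "0 < (1 - p) ^ n"
    using p n(2) by (auto simp: power_less_one_iff)
  then have uv: "0 < v n" "v n < u n"
    using r by (auto simp: u_def v_def algebra_simps add_pos_pos)
  have end_neq: "\<gamma> k n \<noteq> \<rho>" if "k < d" for k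
    using \<gamma>[OF that] n(2) unfolding infinite_path_from_def by (metis inj_eq not_one_le_zero)
  have inj: "inj_on (\<lambda>k. \<gamma> k n) {..m}"
  proof (rule inj_onI, rule ccontr)
    fix k l assume "k \<in> {..m}" "l \<in> {..m}" "\<gamma> k n = \<gamma> l n" "k \<noteq> l"
    then show False
      using disj[of k l] end_neq[of k] m(2) by (metis IntI atMost_iff le_less_trans rangeI singletonD)
  qed
  have vacant: "prob {\<omega> \<in> space M. \<forall>i\<in>(\<lambda>k. \<gamma> k n) ` J. \<not> X i \<omega>}
      = r * u n ^ card J + (1 - r) * v n ^ card J" if "J \<subseteq> {..m}" for J
  proof -
    have "finite J" "\<And>k. k \<in> J \<Longrightarrow> k < d"
      using that m(2) finite_subset by auto
    then show ?thesis
      using prob_star_vacant[OF \<rho>, of J \<gamma> n] \<gamma> disj by (simp add: u_def v_def)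
  qed
  \<comment> \<open>The sum over sets of vertices is to be reindexed by sets of path indices, with
    cardinalities preserved by injectivity.\<close>
  have Pow: "Pow ((\<lambda>k. \<gamma> k n) ` {..m}) = (`) (\<lambda>k. \<gamma> k n) ` Pow {..m}"
    by (rule image_Pow_surj[symmetric]) simp
  have "0 \<le> (\<Sum>J\<in>Pow ((\<lambda>k. \<gamma> k n) ` {..m}). (-1) ^ card J * ln (prob {\<omega> \<in> space M. \<forall>i\<in>J. \<not> X i \<omega>}))"
  proof (rule class_R_alternating_log_nonneg[OF R X_measurable])
    have "\<gamma> k n \<in> V" if "k < d" for k
      using \<gamma>[OF that] edge_in unfolding infinite_path_from_def by blast
    then show "(\<lambda>k. \<gamma> k n) ` {..m} \<subseteq> V"
      using m(2) by auto
    show "0 < prob {\<omega> \<in> space M. \<forall>i\<in>J. \<not> X i \<omega>}" if J: "J \<subseteq> (\<lambda>k. \<gamma> k n) ` {..m}" for J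
    proof -
      obtain L where "L \<subseteq> {..m}" "J = (\<lambda>k. \<gamma> k n) ` L"
        using J by (rule subset_imageE)
      then show ?thesis
        using uv r by (simp only: vacant) (intro add_pos_pos mult_pos_pos zero_less_power; simp)
    qed
  qed auto
  also have "\<dots> = (\<Sum>J\<in>Pow {..m}. (-1) ^ card J * ln (r * u n ^ card J + (1 - r) * v n ^ card J))"
    unfolding Pow
  proof (subst sum.reindex)
    show "inj_on ((`) (\<lambda>k. \<gamma> k n)) (Pow {..m})"
      using inj by (rule inj_on_image_Pow)
    have "card ((\<lambda>k. \<gamma> k n) ` J) = card J" if "J \<in> Pow {..m}" for J
      using that inj by (intro card_image) (auto intro: inj_on_subset)
    then show "sum ((\<lambda>J. (-1) ^ card J * ln (prob {\<omega> \<in> space M. \<forall>i\<in>J. \<not> X i \<omega>})) \<circ> (`) (\<lambda>k. \<gamma> k n)) (Pow {..m})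
        = (\<Sum>J\<in>Pow {..m}. (-1) ^ card J * ln (r * u n ^ card J + (1 - r) * v n ^ card J))"
      by (intro sum.cong refl) (simp only: o_apply vacant Pow_iff)
  qed
  also have "\<dots> < 0"
    using neg[OF uv n(1)] .
  finally show False by simp
qed

theorem theorem6p1:
  fixes V :: "'v set" and E :: "'v \<Rightarrow> 'v \<Rightarrow> bool" and v\<^sub>0 :: 'v and d :: nat
    and p r :: real and M :: "'a measure" and X :: "'v \<Rightarrow> 'a \<Rightarrow> bool"
  assumes "3 \<le> d"
    and "is_tree V E" and "countable V"
    and "v\<^sub>0 \<in> V" and "has_disjoint_infinite_paths E v\<^sub>0 d"
    and "0 < p" and "p < 1" and "0 < r" and "r < 1"
    and "tree_markov_chain V E p r M X"
    and "r < 1 / (1 - r2 d)"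
  shows "process_law V M X \<notin> class_R TYPE('w) V"
proof -
  interpret prob_space M
    using assms(10) by (simp add: tree_markov_chain_def)
  interpret tree_process M V E p r X
    using assms by unfold_locales (auto simp: tree_markov_chain_def)
  obtain \<rho> where "\<rho> \<in> V"
    and root: "\<And>b. prob {\<omega> \<in> space M. X \<rho> \<omega> = b} = pmf (bernoulli_pmf (1 - r)) b"
    and step: "\<And>F i j x b. finite F \<and> F \<subseteq> V \<and> \<rho> \<in> F \<and> connected_on E F \<and> i \<in> F \<and> j \<in> V - F \<and> E i j \<Longrightarrow>
      prob {\<omega> \<in> space M. (\<forall>k\<in>F. X k \<omega> = x k) \<and> X j \<omega> = b} =
      prob {\<omega> \<in> space M. \<forall>k\<in>F. X k \<omega> = x k} * pmf (markov_step p r (x i)) b"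
    using assms(10) unfolding tree_markov_chain_def by blast
  have "prob (cyl (insert j F) x) = prob (cyl F x) * pmf (markov_step p r (x i)) (x j)"
    if "finite F" "F \<subseteq> V" "\<rho> \<in> F" "connected_on E F" "i \<in> F" "j \<notin> F" "E i j" for F i j x
  proof -
    have "cyl (insert j F) x = {\<omega> \<in> space M. (\<forall>k\<in>F. X k \<omega> = x k) \<and> X j \<omega> = x j}"
      by (auto simp: cyl_def)
    then show ?thesis
      using step[of F i j x "x j"] that edge_in by (simp add: cyl_def)
  qed
  moreover have "prob (cyl {\<rho>} (\<lambda>_. b)) = pmf (bernoulli_pmf (1 - r)) b" for b
    using root[of b] by (simp add: cyl_def)
  ultimately have "rooted_chain \<rho>"
    unfolding rooted_chain_def using \<open>\<rho> \<in> V\<close> by blast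
  \<comment> \<open>The root supplied by the definition of the chain is arbitrary; it is moved to
    \<open>v\<^sub>0\<close>, the centre of the paths.\<close>
  then show ?thesis
    using rooted_chain_any_root assms(4,5,1,11) by (intro process_law_notin_class_R)
qed

end
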